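(* Run the bidirectional-search method described in the context on any sequence of arc additions to an initially arcless directed graph on a fixed vertex set. Then: (i) every bidirectional search terminates; (ii) when an arc $(v,w)$ is added, the method reports a cycle if and only if the graph obtained by adding $(v,w)$ contains a cycle, and a reported cycle (path from $w$ to $x$ traversed forward, then path from $x$ to $v$ traversed backward, then $(v,w)$) is indeed a cycle; (iii) after every arc addition that does not create a cycle, the maintained vertex order is a topological order of the current graph.
   Context: Setting: a fixed finite vertex set $V$; initially there are no arcs; arcs are added one at a time (the process stops once a cycle is reported). A topological order of a directed graph is a total order $<$ of its vertices such that $x<y$ for every arc $(x,y)$. The method maintains a total order $<$ of $V$ (initially arbitrary), stored in a dynamic ordered-list structure supporting order queries, deletion of a vertex, and reinsertion of a vertex just before or just after another vertex; and for each vertex the set of its outgoing arcs and the set of its incoming arcs. To add an arc $(v,w)$: add $(v,w)$ to the outgoing set of $v$ and the incoming set of $w$. If $v<w$, nothing else is done. If $v>w$, perform a bidirectional search forward from $w$ and backward from $v$. A vertex is forward if it is $w$ or has been reached from $w$ by a path of arcs traversed forward; it is backward if it is $v$ or has been reached from $v$ by a path of arcs traversed backward. A forward vertex is scanned if all its outgoing arcs have been traversed; a backward vertex is scanned if all its incoming arcs have been traversed. The search traverses (in any order) arcs forward out of forward vertices (the head then becomes forward) and arcs backward into backward vertices (the tail then becomes backward), until either (a) a forward traversal reaches a backward vertex $x$ or a backward traversal reaches a forward vertex $x$, in which case it stops and reports the cycle consisting of a path from $w$ to $x$ traversed forward, a path from $x$ to $v$ traversed backward, and $(v,w)$; or (b)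 there is a vertex $s$ such that all forward vertices less than $s$ and all backward vertices greater than $s$ are scanned. In case (b), let $X$ be the set of forward vertices less than $s$ and $Y$ the set of backward vertices greater than $s$; compute topological orders $O_X$ and $O_Y$ of the subgraphs induced by $X$ and by $Y$. If $s$ is not forward, delete the vertices of $X\cup Y$ from the order and reinsert them just after $s$, in order $O_Y$ followed by $O_X$; otherwise ($s$ not backward) symmetrically reinsert them just before $s$, in order $O_Y$ followed by $O_X$. *)

theory Defs
  imports "Graph_Theory.Graph_Theory"
begin

text \<open>Arcs are pairs of vertices, and the arc set of a graph is a set, so adding an arc a second
  time does not change the graph.\<close>

abbreviation digraph_of :: "'a set \<Rightarrow> ('a \<times> 'a) set \<Rightarrow> ('a, 'a \<times> 'a) pre_digraph" where
  "digraph_of V E \<equiv> with_proj \<lparr>pverts = V, parcs = E\<rparr>"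

definition topological_order :: "('a, 'b) pre_digraph \<Rightarrow> 'a rel \<Rightarrow> bool" where
  "topological_order G r \<longleftrightarrow>
     r \<subseteq> verts G \<times> verts G \<and> strict_linear_order_on (verts G) r \<and> arcs_ends G \<subseteq> r"

text \<open>The ordered-list structure is a duplicate-free list enumerating the vertices.\<close>

definition list_order :: "'a list \<Rightarrow> 'a rel" where
  "list_order L = {(L ! i, L ! j) | i j. i < j \<and> j < length L}"

definition topological_list :: "('a, 'b) pre_digraph \<Rightarrow> 'a list \<Rightarrow> bool" where
  "topological_list G L \<longleftrightarrow>
     distinct L \<and> set L = verts G \<and> topological_order G (list_order L)"

primrec insert_after :: "'a \<Rightarrow> 'a list \<Rightarrow> 'a list \<Rightarrow> 'a list" where
  "insert_after s xs [] = []"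
| "insert_after s xs (y # ys) = (if y = s then y # xs @ ys else y # insert_after s xs ys)"

primrec insert_before :: "'a \<Rightarrow> 'a list \<Rightarrow> 'a list \<Rightarrow> 'a list" where
  "insert_before s xs [] = []"
| "insert_before s xs (y # ys) = (if y = s then xs @ y # ys else y # insert_before s xs ys)"


text \<open>Throughout, \<open>TF\<close> and \<open>TB\<close> are the sets of arcs already traversed forward and backward by the
  search caused by a new arc \<open>(v, w)\<close>, and \<open>G\<close> is the graph that already contains this arc.\<close>

definition forward_verts :: "'a \<Rightarrow> 'a rel \<Rightarrow> 'a set" where
  "forward_verts w TF = {x. (w, x) \<in> TF\<^sup>*}"

definition backward_verts :: "'a \<Rightarrow> 'a rel \<Rightarrow> 'a set" where
  "backward_verts v TB = {x. (x, v) \<in> TB\<^sup>*}"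

definition separator ::
  "('a, 'a \<times> 'a) pre_digraph \<Rightarrow> 'a list \<Rightarrow> 'a \<Rightarrow> 'a \<Rightarrow> 'a rel \<Rightarrow> 'a rel \<Rightarrow> 'a \<Rightarrow> bool" where
  "separator G L v w TF TB s \<longleftrightarrow>
     s \<in> verts G \<and>
     (\<forall>x \<in> forward_verts w TF. (x, s) \<in> list_order L \<longrightarrow> out_arcs G x \<subseteq> TF) \<and>
     (\<forall>y \<in> backward_verts v TB. (s, y) \<in> list_order L \<longrightarrow> in_arcs G y \<subseteq> TB)"

text \<open>\<open>Met x\<close> is the stopped state (a), \<open>Separated s\<close> the stopped state (b).\<close>

datatype 'a search =
    Searching "'a rel" "'a rel"
  | Met 'a "'a rel" "'a rel"
  | Separated 'a "'a rel" "'a rel"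

inductive search_step ::
  "('a, 'a \<times> 'a) pre_digraph \<Rightarrow> 'a list \<Rightarrow> 'a \<Rightarrow> 'a \<Rightarrow> 'a search \<Rightarrow> 'a search \<Rightarrow> bool"
  for G :: "('a, 'a \<times> 'a) pre_digraph" and L :: "'a list" and v w :: 'a
where
  separate:
    "separator G L v w TF TB s \<Longrightarrow>
     search_step G L v w (Searching TF TB) (Separated s TF TB)"
| forward:
    "\<lbrakk>\<nexists>s. separator G L v w TF TB s;
      x \<in> forward_verts w TF; (x, y) \<in> out_arcs G x - TF; y \<notin> backward_verts v TB\<rbrakk> \<Longrightarrow>
     search_step G L v w (Searching TF TB) (Searching (insert (x, y) TF) TB)"
| forward_meet:
    "\<lbrakk>\<nexists>s. separator G L v w TF TB s;
      x \<in> forward_verts w TF; (x, y) \<in> out_arcs G x - TF; y \<in> backward_verts v TB\<rbrakk> \<Longrightarrow>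
     search_step G L v w (Searching TF TB) (Met y (insert (x, y) TF) TB)"
| backward:
    "\<lbrakk>\<nexists>s. separator G L v w TF TB s;
      y \<in> backward_verts v TB; (x, y) \<in> in_arcs G y - TB; x \<notin> forward_verts w TF\<rbrakk> \<Longrightarrow>
     search_step G L v w (Searching TF TB) (Searching TF (insert (x, y) TB))"
| backward_meet:
    "\<lbrakk>\<nexists>s. separator G L v w TF TB s;
      y \<in> backward_verts v TB; (x, y) \<in> in_arcs G y - TB; x \<in> forward_verts w TF\<rbrakk> \<Longrightarrow>
     search_step G L v w (Searching TF TB) (Met x TF (insert (x, y) TB))"

abbreviation search_start :: "'a search" where
  "search_start \<equiv> Searching {} {}"

text \<open>\<open>Cycle P x Q\<close> reports the arc list \<open>P @ Q @ [(v, w)]\<close>, where \<open>P\<close> leads from \<open>w\<close> to \<open>x\<close> and \<open>Q\<close>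
  from \<open>x\<close> to \<open>v\<close>. \<open>Reordered L'\<close> reports no cycle and leaves \<open>L'\<close> as the maintained order, also if
  \<open>L'\<close> is the old order.\<close>

datatype 'a outcome = Cycle "('a \<times> 'a) list" 'a "('a \<times> 'a) list" | Reordered "'a list"

inductive search_outcome ::
  "('a, 'a \<times> 'a) pre_digraph \<Rightarrow> 'a list \<Rightarrow> 'a \<Rightarrow> 'a \<Rightarrow> 'a search \<Rightarrow> 'a outcome \<Rightarrow> bool"
  for G :: "('a, 'a \<times> 'a) pre_digraph" and L :: "'a list" and v w :: 'a
where
  report:
    "\<lbrakk>pre_digraph.awalk (digraph_of (verts G) TF) w P x;
      pre_digraph.awalk (digraph_of (verts G) TB) x Q v\<rbrakk> \<Longrightarrow>
     search_outcome G L v w (Met x TF TB) (Cycle P x Q)"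
| reorder:
    "\<lbrakk>X = {x \<in> forward_verts w TF. (x, s) \<in> list_order L};
      Y = {y \<in> backward_verts v TB. (s, y) \<in> list_order L};
      topological_list (G \<restriction> X) OX; topological_list (G \<restriction> Y) OY;
      L0 = filter (\<lambda>x. x \<notin> X \<union> Y) L;
      L' = (if s \<notin> forward_verts w TF then insert_after s (OY @ OX) L0
            else insert_before s (OY @ OX) L0)\<rbrakk> \<Longrightarrow>
     search_outcome G L v w (Separated s TF TB) (Reordered L')"

text \<open>A loop \<open>(v, v)\<close> needs no search: \<open>v\<close> is at once a forward and a backward vertex.\<close>

inductive add_arc_outcome ::
  "('a, 'a \<times> 'a) pre_digraph \<Rightarrow> 'a list \<Rightarrow> 'a \<Rightarrow> 'a \<Rightarrow> 'a outcome \<Rightarrow> bool"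
  for G :: "('a, 'a \<times> 'a) pre_digraph" and L :: "'a list" and v w :: 'a
where
  in_order: "(v, w) \<in> list_order L \<Longrightarrow> add_arc_outcome G L v w (Reordered L)"
| loop: "v = w \<Longrightarrow> add_arc_outcome G L v w (Cycle [] v [])"
| search:
    "\<lbrakk>(w, v) \<in> list_order L;
      (search_step G L v w)\<^sup>*\<^sup>* search_start \<sigma>; search_outcome G L v w \<sigma> out\<rbrakk> \<Longrightarrow>
     add_arc_outcome G L v w out"

text \<open>\<open>run V es L\<close>: the method can process the additions \<open>es\<close> without reporting a cycle, in such
  a way that \<open>L\<close> is then the maintained order.\<close>

inductive run :: "'a set \<Rightarrow> ('a \<times> 'a) list \<Rightarrow> 'a list \<Rightarrow> bool" for V :: "'a set" where
  init: "\<lbrakk>distinct L; set L = V\<rbrakk> \<Longrightarrow> run V [] L"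
| add:
    "\<lbrakk>run V es L; v \<in> V; w \<in> V;
      add_arc_outcome (digraph_of V (set (es @ [(v, w)]))) L v w (Reordered L')\<rbrakk> \<Longrightarrow>
     run V (es @ [(v, w)]) L'"

end

theory Submission
  imports Defs
begin

text \<open>As long as the search has not stopped, the forward and the backward vertices are disjoint, so
  the new arc \<open>(v, w)\<close> is never traversed and all traversed arcs are old. When the two sides meet,
  the reported walk from \<open>w\<close> to \<open>v\<close> hence lies in the old acyclic graph; it is a path, and \<open>(v, w)\<close>
  closes it to a cycle. When there is a separator \<open>s\<close>, scannedness makes \<open>X\<close> closed under arcs
  to vertices below \<open>s\<close> and \<open>Y\<close> closed under arcs from vertices above \<open>s\<close>, and no old arc leads from \<open>X\<close>
  to \<open>Y\<close>, so moving \<open>Y\<close> and \<open>X\<close> to \<open>s\<close> keeps every old arc in order and puts \<open>v\<close> before \<open>w\<close>.\<close>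

section \<open>List orders\<close>

lemma list_order_Nil [simp]: "list_order [] = {}"
  by (simp add: list_order_def)

text \<open>Trades list indices for structural recursion. Together with
  \<open>list_order_append\<close> it lets simplification compute the order of any
  concatenation.\<close>

lemma list_order_Cons [simp]: "list_order (x # xs) = {x} \<times> set xs \<union> list_order xs"
proof (intro equalityI subrelI)
  fix a b assume "(a, b) \<in> list_order (x # xs)"
  then obtain i j where ij: "i < j" "j < length (x # xs)" "a = (x # xs) ! i" "b = (x # xs) ! j"
    by (auto simp: list_order_def)
  then obtain j' where j': "j = Suc j'" by (cases j) auto
  show "(a, b) \<in> {x} \<times> set xs \<union> list_order xs"
    using ij j' by (cases i) (auto simp: list_order_def)
next
  fix a b assume "(a, b) \<in> {x} \<times> set xs \<union> list_order xs"
  then consider "a = x" "b \<in> set xs" | "(a, b) \<in> list_order xs" by auto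
  then show "(a, b) \<in> list_order (x # xs)"
  proof cases
    case 1
    then obtain j where "j < length xs" "b = xs ! j" by (auto simp: in_set_conv_nth)
    with 1 have "a = (x # xs) ! 0" "b = (x # xs) ! Suc j" "0 < Suc j" "Suc j < length (x # xs)"
      by auto
    then show ?thesis unfolding list_order_def by blast
  next
    case 2
    then obtain i j where "i < j" "j < length xs" "a = xs ! i" "b = xs ! j"
      by (auto simp: list_order_def)
    then have "a = (x # xs) ! Suc i" "b = (x # xs) ! Suc j" "Suc i < Suc j"
      "Suc j < length (x # xs)"
      by auto
    then show ?thesis unfolding list_order_def by blast
  qed
qed

lemma list_order_append [simp]:
  "list_order (xs @ ys) = list_order xs \<union> list_order ys \<union> set xs \<times> set ys"
  by (induction xs) auto

lemma list_order_filter: "list_order (filter P xs) = {(x, y) \<in> list_order xs. P x \<and> P y}"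
  by (induction xs) auto

lemma list_order_subset: "list_order xs \<subseteq> set xs \<times> set xs"
  by (induction xs) auto

lemma trans_list_order: "distinct xs \<Longrightarrow> trans (list_order xs)"
proof (induction xs)
  case (Cons x xs)
  then have "trans (list_order xs)" "x \<notin> set xs" by auto
  then show ?case
    using list_order_subset[of xs] unfolding trans_def list_order_Cons by blast
qed simp

lemma irrefl_list_order: "distinct xs \<Longrightarrow> irrefl (list_order xs)"
  by (induction xs) (auto simp: irrefl_def)

lemma total_on_list_order: "total_on (set xs) (list_order xs)"
  by (induction xs) (auto simp: total_on_def)

lemma acyclic_list_order: "distinct xs \<Longrightarrow> acyclic (list_order xs)"
  by (simp add: acyclic_irrefl irrefl_list_order trans_list_order)

text \<open>A duplicate-free list always orders its elements strictly and totally, so only the arcs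
  remain to be checked.\<close>

lemma topological_list_iff:
  "topological_list G L \<longleftrightarrow> distinct L \<and> set L = verts G \<and> arcs_ends G \<subseteq> list_order L"
  using list_order_subset[of L] trans_list_order[of L] irrefl_list_order[of L]
    total_on_list_order[of L]
  by (auto simp: topological_list_def topological_order_def strict_linear_order_on_def)

lemma insert_after_split: "s \<notin> set xs \<Longrightarrow> insert_after s zs (xs @ s # ys) = xs @ s # zs @ ys"
  by (induction xs) auto

lemma insert_before_split: "s \<notin> set xs \<Longrightarrow> insert_before s zs (xs @ s # ys) = xs @ zs @ s # ys"
  by (induction xs) auto

section \<open>Walks and cycles\<close>

lemma wf_digraph_of: "E \<subseteq> V \<times> V \<Longrightarrow> wf_digraph (digraph_of V E)"
  by unfold_locales auto

lemma trancl_iff_awalk: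
  assumes "E \<subseteq> V \<times> V"
  shows "(u, v) \<in> E\<^sup>+ \<longleftrightarrow> (\<exists>p. pre_digraph.awalk (digraph_of V E) u p v \<and> p \<noteq> [])"
  using wf_digraph.reachable1_awalk[OF wf_digraph_of[OF assms]] by simp

lemma rtrancl_imp_awalk:
  assumes "E \<subseteq> V \<times> V" "(u, v) \<in> E\<^sup>*" "u \<in> V"
  shows "\<exists>p. pre_digraph.awalk (digraph_of V E) u p v"
proof (cases "u = v")
  case True
  then have "pre_digraph.awalk (digraph_of V E) u [] v"
    using assms(3) by (simp add: wf_digraph.awalk_Nil_iff[OF wf_digraph_of[OF assms(1)]])
  then show ?thesis ..
next
  case False
  then show ?thesis
    using assms by (auto simp: rtrancl_eq_or_trancl trancl_iff_awalk)
qed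

lemma awalk_mono:
  assumes "pre_digraph.awalk (digraph_of V E) u p v" "E \<subseteq> E'"
  shows "pre_digraph.awalk (digraph_of V E') u p v"
  using assms by (auto simp: pre_digraph.awalk_def cas_with_proj_eq)

text \<open>A repeated vertex would cut a nonempty closed walk out of the given one.\<close>

lemma distinct_awalk_verts_if_acyclic:
  assumes "E \<subseteq> V \<times> V" "acyclic E" "pre_digraph.awalk (digraph_of V E) u p v"
  shows "distinct (pre_digraph.awalk_verts (digraph_of V E) u p)"
proof (rule ccontr)
  interpret wf_digraph "digraph_of V E" by (rule wf_digraph_of[OF assms(1)])
  assume "\<not> ?thesis"
  then obtain q r s x where "r \<noteq> []" "awalk x r x"
    using awalk_not_distinct_decomp[OF assms(3)] by auto
  then have "(x, x) \<in> E\<^sup>+" using trancl_iff_awalk[OF assms(1)] by blast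
  then show False using assms(2) by (simp add: acyclic_def)
qed

lemma no_cycle_if_acyclic:
  assumes "E \<subseteq> V \<times> V" "acyclic E"
  shows "\<nexists>p. pre_digraph.cycle (digraph_of V E) p"
  using assms trancl_iff_awalk[OF assms(1)]
  unfolding pre_digraph.cycle_def acyclic_def by blast

text \<open>The walk avoids the new arc, so acyclicity of \<open>E\<close> makes it simple; only the
  start vertex is repeated once the new arc closes it.\<close>

lemma cycle_if_awalk_acyclic:
  assumes "E \<subseteq> V \<times> V" "acyclic E" "v \<in> V" "w \<in> V"
    and p: "pre_digraph.awalk (digraph_of V E) w p v"
  shows "pre_digraph.cycle (digraph_of V (insert (v, w) E)) (p @ [(v, w)])"
proof -
  have sub: "insert (v, w) E \<subseteq> V \<times> V" using assms by auto
  interpret G: wf_digraph "digraph_of V (insert (v, w) E)" by (rule wf_digraph_of[OF sub])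
  have p': "G.awalk w p v" using awalk_mono[OF p] by auto
  have e: "G.awalk v [(v, w)] w" using assms by (simp add: G.awalk_simps)
  have c: "G.awalk w (p @ [(v, w)]) w" using G.awalk_appendI[OF p' e] .
  have d: "distinct (G.awalk_verts w p)"
    using distinct_awalk_verts_if_acyclic[OF assms(1,2) p] by (simp add: awalk_verts_with_proj_eq)
  show ?thesis
  proof (cases "p = []")
    \<comment> \<open>An empty walk forces \<open>v = w\<close>, and the new arc alone is the
      cycle.\<close>
    case True
    then show ?thesis using c unfolding G.cycle_def by (auto intro!: exI[of _ w])
  next
    case False
    have "tl (G.awalk_verts w (p @ [(v, w)])) = tl (G.awalk_verts w p) @ [w]"
      using G.awalk_verts_append[OF c] G.awlast_of_awalk[OF p']
      by (simp add: G.awalk_verts_conv)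
    moreover have "G.awalk_verts w p = w # tl (G.awalk_verts w p)"
      using G.awhd_of_awalk[OF p'] G.awalk_verts_non_Nil[of w p] by (metis list.collapse)
    \<comment> \<open>Dropping the first vertex \<open>w\<close> and appending it at the end is a
      rotation of the vertex list of \<open>p\<close>.\<close>
    ultimately have "distinct (tl (G.awalk_verts w (p @ [(v, w)])))"
      using d by (metis distinct1_rotate rotate1.simps(2))
    then show ?thesis using c unfolding G.cycle_def by blast
  qed
qed

section \<open>The bidirectional search\<close>

lemma start_in_forward_verts [simp]: "w \<in> forward_verts w TF"
  by (simp add: forward_verts_def)

lemma start_in_backward_verts [simp]: "v \<in> backward_verts v TB"
  by (simp add: backward_verts_def)

lemma backward_verts_converse: "backward_verts v TB = forward_verts v (TB\<inverse>)"
  by (simp add: backward_verts_def forward_verts_def rtrancl_converse)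

lemma forward_verts_mono: "TF \<subseteq> TF' \<Longrightarrow> forward_verts w TF \<subseteq> forward_verts w TF'"
  unfolding forward_verts_def using rtrancl_mono by blast

lemma forward_verts_step: "x \<in> forward_verts w TF \<Longrightarrow> (x, y) \<in> TF \<Longrightarrow> y \<in> forward_verts w TF"
  by (auto simp: forward_verts_def)

lemma backward_verts_step: "y \<in> backward_verts v TB \<Longrightarrow> (x, y) \<in> TB \<Longrightarrow> x \<in> backward_verts v TB"
  by (auto simp: backward_verts_def)

text \<open>The second assumption says that heads of traversed arcs are already forward. Hence a
  newly reached \<open>y\<close> cannot make further vertices reachable through arcs in
  \<open>TF\<close>.\<close>

lemma forward_verts_insert:
  assumes "x \<in> forward_verts w TF" "snd ` TF \<subseteq> forward_verts w TF"
  shows "forward_verts w (insert (x, y) TF) = insert y (forward_verts w TF)"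
proof
  show "forward_verts w (insert (x, y) TF) \<subseteq> insert y (forward_verts w TF)"
  proof
    fix z assume "z \<in> forward_verts w (insert (x, y) TF)"
    then have "(w, z) \<in> (insert (x, y) TF)\<^sup>*" by (simp add: forward_verts_def)
    then show "z \<in> insert y (forward_verts w TF)"
      by (induction rule: rtrancl_induct) (use assms(2) in force)+
  qed
  have mono: "forward_verts w TF \<subseteq> forward_verts w (insert (x, y) TF)"
    by (intro forward_verts_mono subset_insertI)
  then have "x \<in> forward_verts w (insert (x, y) TF)" using assms(1) by blast
  then have "y \<in> forward_verts w (insert (x, y) TF)"
    by (rule forward_verts_step) simp
  then show "insert y (forward_verts w TF) \<subseteq> forward_verts w (insert (x, y) TF)"
    using mono by blast
qed

lemma backward_verts_insert:
  assumes "y \<in> backward_verts v TB" "fst ` TB \<subseteq> backward_verts v TB"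
  shows "backward_verts v (insert (x, y) TB) = insert x (backward_verts v TB)"
proof -
  have "(insert (x, y) TB)\<inverse> = insert (y, x) (TB\<inverse>)" by auto
  moreover have "snd ` (TB\<inverse>) \<subseteq> forward_verts v (TB\<inverse>)"
    using assms(2) by (force simp: backward_verts_converse)
  ultimately show ?thesis
    using assms(1) forward_verts_insert[of y v "TB\<inverse>" x] by (simp add: backward_verts_converse)
qed

text \<open>Every step that does not stop the search traverses an arc not traversed before in that
  direction.\<close>

fun untraversed :: "('a, 'a \<times> 'a) pre_digraph \<Rightarrow> 'a search \<Rightarrow> nat" where
  "untraversed G (Searching TF TB) = Suc (card (arcs G - TF) + card (arcs G - TB))"
| "untraversed G _ = 0"

text \<open>A traversed arc leaves one of the two finite sets of remaining arcs. The
  \<open>Suc\<close> in the measure makes the stopping steps, which lead to 0, decrease it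
  too.\<close>

lemma untraversed_decreases:
  assumes "finite (arcs G)" "search_step G L v w \<sigma> \<sigma>'"
  shows "untraversed G \<sigma>' < untraversed G \<sigma>"
proof -
  have "card (arcs G - insert e T) < card (arcs G - T)" if "e \<in> arcs G - T" for e T
    by (rule psubset_card_mono) (use that assms(1) in auto)
  with assms(2) show ?thesis by cases (auto simp: out_arcs_def in_arcs_def)
qed

text \<open>\<open>termip\<close> speaks of all step sequences, so termination holds for every order
  of traversal.\<close>

lemma termip_search_step:
  assumes "finite (arcs G)"
  shows "termip (search_step G L v w) \<sigma>"
proof (rule accp_wfpD)
  show "wfP (search_step G L v w)\<inverse>\<inverse>"
    unfolding wfp_def
    by (rule wf_subset[OF wf_measure[of "untraversed G"]])
      (auto dest: untraversed_decreases[OF assms])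
qed

text \<open>If no arc can be traversed, all forward and backward vertices are scanned, and then any
  vertex is a separator.\<close>

lemma search_step_progress:
  assumes "s \<in> verts (with_proj H)"
  shows "\<exists>\<sigma>. search_step (with_proj H) L v w (Searching TF TB) \<sigma>"
proof (rule ccontr)
  let ?G = "with_proj H"
  assume *: "\<nexists>\<sigma>. search_step ?G L v w (Searching TF TB) \<sigma>"
  then have nosep: "\<nexists>s. separator ?G L v w TF TB s"
    by (metis search_step.separate)
  have "out_arcs ?G x \<subseteq> TF" if "x \<in> forward_verts w TF" for x
  proof
    fix e assume "e \<in> out_arcs ?G x"
    then show "e \<in> TF"
      using * that search_step.forward[OF nosep that] search_step.forward_meet[OF nosep that]
      by (cases e) (force simp: out_arcs_def)
  qed
  moreover have "in_arcs ?G y \<subseteq> TB" if "y \<in> backward_verts v TB" for y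
  proof
    fix e assume "e \<in> in_arcs ?G y"
    then show "e \<in> TB"
      using * that search_step.backward[OF nosep that] search_step.backward_meet[OF nosep that]
      by (cases e) (force simp: in_arcs_def)
  qed
  ultimately have "separator ?G L v w TF TB s"
    using assms by (auto simp: separator_def)
  with nosep show False by blast
qed

section \<open>Searches for a new arc that contradicts the current order\<close>

locale arc_insertion =
  fixes V :: "'a set" and E :: "'a rel" and L :: "'a list" and v w :: 'a
  assumes distinct_L: "distinct L" and set_L: "set L = V"
    and arcs_in_order: "E \<subseteq> list_order L" and against_order: "(w, v) \<in> list_order L"
begin

abbreviation G :: "('a, 'a \<times> 'a) pre_digraph" where
  "G \<equiv> digraph_of V (insert (v, w) E)"

lemma ends_in_V: "v \<in> V" "w \<in> V"
  using against_order list_order_subset[of L] set_L by auto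

lemma arcs_in_V: "E \<subseteq> V \<times> V"
  using arcs_in_order list_order_subset[of L] set_L by auto

lemma acyclic_E: "acyclic E"
  using acyclic_list_order[OF distinct_L] arcs_in_order by (rule acyclic_subset)

text \<open>While searching, the conditions on \<open>snd\<close> and \<open>fst\<close> images
  supply the premises of the two insertion lemmas. Each stopped state keeps only what its outcome
  needs: old walks through the meeting vertex, or disjoint sides with a separator.\<close>

fun search_inv :: "'a search \<Rightarrow> bool" where
  "search_inv (Searching TF TB) \<longleftrightarrow>
     TF \<subseteq> E \<and> TB \<subseteq> E \<and> snd ` TF \<subseteq> forward_verts w TF \<and> fst ` TB \<subseteq> backward_verts v TB \<and>
     forward_verts w TF \<inter> backward_verts v TB = {}"
| "search_inv (Met x TF TB) \<longleftrightarrow>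
     TF \<subseteq> E \<and> TB \<subseteq> E \<and> x \<in> forward_verts w TF \<and> x \<in> backward_verts v TB"
| "search_inv (Separated s TF TB) \<longleftrightarrow>
     forward_verts w TF \<inter> backward_verts v TB = {} \<and> separator G L v w TF TB s"

lemma disjoint_ends:
  assumes "forward_verts w TF \<inter> backward_verts v TB = {}"
  shows "v \<notin> forward_verts w TF" "w \<notin> backward_verts v TB"
  using assms start_in_forward_verts[of w TF] start_in_backward_verts[of v TB] by blast+

lemma search_inv_start: "search_inv search_start"
  \<comment> \<open>Initially the two sides are \<open>{w}\<close> and \<open>{v}\<close>, so
    disjointness amounts to \<open>w \<noteq> v\<close>.\<close>
  using against_order irrefl_list_order[OF distinct_L]
  by (auto simp: forward_verts_def backward_verts_def irrefl_def)

lemma search_inv_step: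
  assumes "search_step G L v w \<sigma> \<sigma>'" "search_inv \<sigma>"
  shows "search_inv \<sigma>'"
  using assms(1)
proof cases
  case (separate TF TB s)
  with assms(2) show ?thesis by simp
next
  case (forward TF TB x y)
  with assms(2) have inv: "search_inv (Searching TF TB)" by simp
  \<comment> \<open>The new arc leaves \<open>v\<close>, which is backward and hence not forward; an
    arc out of the forward vertex \<open>x\<close> is therefore old.\<close>
  then have "x \<noteq> v" using forward disjoint_ends(1)[of TF TB] by auto
  then have "(x, y) \<in> E" using forward by (simp add: out_arcs_def)
  moreover have "forward_verts w (insert (x, y) TF) = insert y (forward_verts w TF)"
    by (rule forward_verts_insert) (use forward(4) inv in simp_all)
  ultimately show ?thesis
    using forward(2,6) inv by (simp add: subset_insertI2)
next
  case (forward_meet TF TB x y)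
  with assms(2) have inv: "search_inv (Searching TF TB)" by simp
  then have "x \<noteq> v" using forward_meet disjoint_ends(1)[of TF TB] by auto
  then have "(x, y) \<in> E" using forward_meet by (simp add: out_arcs_def)
  moreover have "forward_verts w (insert (x, y) TF) = insert y (forward_verts w TF)"
    by (rule forward_verts_insert) (use forward_meet(4) inv in simp_all)
  ultimately show ?thesis
    using forward_meet(2,6) inv by (simp add: subset_insertI2)
next
  case (backward TF TB y x)
  with assms(2) have inv: "search_inv (Searching TF TB)" by simp
  \<comment> \<open>Dually, the new arc enters \<open>w\<close>, which is not backward.\<close>
  then have "y \<noteq> w" using backward disjoint_ends(2)[of TF TB] by auto
  then have "(x, y) \<in> E" using backward by (simp add: in_arcs_def)
  moreover have "backward_verts v (insert (x, y) TB) = insert x (backward_verts v TB)"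
    by (rule backward_verts_insert) (use backward(4) inv in simp_all)
  ultimately show ?thesis
    using backward(2,6) inv by (simp add: subset_insertI2)
next
  case (backward_meet TF TB y x)
  with assms(2) have inv: "search_inv (Searching TF TB)" by simp
  then have "y \<noteq> w" using backward_meet disjoint_ends(2)[of TF TB] by auto
  then have "(x, y) \<in> E" using backward_meet by (simp add: in_arcs_def)
  moreover have "backward_verts v (insert (x, y) TB) = insert x (backward_verts v TB)"
    by (rule backward_verts_insert) (use backward_meet(4) inv in simp_all)
  ultimately show ?thesis
    using backward_meet(2,6) inv by (simp add: subset_insertI2)
qed

lemma search_inv_reachable:
  assumes "(search_step G L v w)\<^sup>*\<^sup>* search_start \<sigma>"
  shows "search_inv \<sigma>"
  using assms
proof (induction rule: rtranclp_induct)
  case base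
  show ?case by (rule search_inv_start)
next
  case (step \<sigma> \<sigma>')
  show ?case by (rule search_inv_step[OF step.hyps(2) step.IH])
qed

text \<open>Omitting an end of the new arc leaves only old arcs, and the current order already sorts
  those. This provides the lists \<open>OX\<close> and \<open>OY\<close>.\<close>

lemma topological_list_induce:
  assumes "S \<subseteq> V" "v \<notin> S \<or> w \<notin> S"
  shows "topological_list (G \<restriction> S) (filter (\<lambda>x. x \<in> S) L)"
  using assms arcs_in_order set_L distinct_L
  by (auto simp: topological_list_iff arcs_ends_conv list_order_filter)

lemma search_outcome_exists:
  assumes inv: "search_inv \<sigma>" and final: "\<nexists>\<sigma>'. search_step G L v w \<sigma> \<sigma>'"
  shows "\<exists>out. search_outcome G L v w \<sigma> out"
proof (cases \<sigma>)
  case (Searching TF TB)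
  have "v \<in> verts G" using ends_in_V by simp
  from search_step_progress[OF this] final Searching show ?thesis by blast
next
  case (Met x TF TB)
  have *: "TF \<subseteq> V \<times> V" "TB \<subseteq> V \<times> V" "(w, x) \<in> TF\<^sup>*" "(x, v) \<in> TB\<^sup>*"
    using inv Met arcs_in_V by (auto simp: forward_verts_def backward_verts_def)
  obtain P where P: "pre_digraph.awalk (digraph_of V TF) w P x"
    using rtrancl_imp_awalk[OF *(1,3) ends_in_V(2)] by blast
  \<comment> \<open>Needed because the walk from \<open>x\<close> to \<open>v\<close> may be
    empty.\<close>
  then have "x \<in> V"
    using wf_digraph.awalk_last_in_verts[OF wf_digraph_of[OF *(1)]] by fastforce
  then obtain Q where "pre_digraph.awalk (digraph_of V TB) x Q v"
    using rtrancl_imp_awalk[OF *(2,4)] by blast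
  with P Met show ?thesis by (auto intro!: exI search_outcome.report)
next
  case (Separated s TF TB)
  let ?X = "{x \<in> forward_verts w TF. (x, s) \<in> list_order L}"
  let ?Y = "{y \<in> backward_verts v TB. (s, y) \<in> list_order L}"
  have disj: "forward_verts w TF \<inter> backward_verts v TB = {}" using inv Separated by simp
  have "?X \<subseteq> V" "?Y \<subseteq> V" using list_order_subset[of L] set_L by auto
  moreover have "v \<notin> ?X" "w \<notin> ?Y" using disjoint_ends[OF disj] by blast+
  ultimately have tops: "topological_list (G \<restriction> ?X) (filter (\<lambda>x. x \<in> ?X) L)"
    "topological_list (G \<restriction> ?Y) (filter (\<lambda>x. x \<in> ?Y) L)"
    using topological_list_induce by blast+
  show ?thesis
    unfolding Separated by (rule exI, rule search_outcome.reorder[OF refl refl tops refl refl])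
qed

lemma topological_list_reorder:
  assumes disj: "forward_verts w TF \<inter> backward_verts v TB = {}"
    and sep: "separator G L v w TF TB s"
    and X: "X = {x \<in> forward_verts w TF. (x, s) \<in> list_order L}"
    and Y: "Y = {y \<in> backward_verts v TB. (s, y) \<in> list_order L}"
    and OX: "topological_list (G \<restriction> X) OX" and OY: "topological_list (G \<restriction> Y) OY"
    and L0: "L0 = filter (\<lambda>x. x \<notin> X \<union> Y) L"
    and L': "L' = (if s \<notin> forward_verts w TF then insert_after s (OY @ OX) L0
                   else insert_before s (OY @ OX) L0)"
  shows "topological_list G L'"
proof -
  have "s \<in> set L" using sep set_L by (simp add: separator_def)
  \<comment> \<open>\<open>A\<close> holds the vertices below \<open>s\<close>, \<open>C\<close>
    those above, so \<open>X\<close> lies in \<open>A\<close> and \<open>Y\<close> in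
    \<open>C\<close>.\<close>
  then obtain A C where L: "L = A @ s # C" by (auto simp: in_set_conv_decomp)
  have dL: "distinct A" "distinct C" "s \<notin> set A" "s \<notin> set C" "set A \<inter> set C = {}"
    using distinct_L L by auto
  have V: "V = set A \<union> {s} \<union> set C" using set_L L by auto
  have less_s: "(x, s) \<in> list_order L \<longleftrightarrow> x \<in> set A" for x
    using L dL list_order_subset[of A] list_order_subset[of C] by auto
  have s_less: "(s, x) \<in> list_order L \<longleftrightarrow> x \<in> set C" for x
    using L dL list_order_subset[of A] list_order_subset[of C] by auto
  have X': "X = forward_verts w TF \<inter> set A" using X less_s by auto
  have Y': "Y = backward_verts v TB \<inter> set C" using Y s_less by auto
  have L0': "L0 = filter (\<lambda>x. x \<notin> X) A @ s # filter (\<lambda>x. x \<notin> Y) C"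
  proof -
    have "filter (\<lambda>x. x \<notin> X \<union> Y) A = filter (\<lambda>x. x \<notin> X) A"
      "filter (\<lambda>x. x \<notin> X \<union> Y) C = filter (\<lambda>x. x \<notin> Y) C"
      using dL X' Y' by (intro filter_cong refl; blast)+
    moreover have "s \<notin> X \<union> Y" using dL X' Y' by blast
    ultimately show ?thesis unfolding L0 L by simp
  qed
  have OX': "distinct OX" "set OX = X" and OX_arcs: "E \<inter> X \<times> X \<subseteq> list_order OX"
    using OX by (auto simp: topological_list_iff arcs_ends_conv)
  have OY': "distinct OY" "set OY = Y" and OY_arcs: "E \<inter> Y \<times> Y \<subseteq> list_order OY"
    using OY by (auto simp: topological_list_iff arcs_ends_conv)
  \<comment> \<open>Vertices in \<open>X\<close> are forward and below the separator, hence
    scanned.\<close>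
  have fwd: "b \<in> forward_verts w TF" if "a \<in> X" "(a, b) \<in> E" for a b
    using sep that less_s X' forward_verts_step[of a w TF b]
    by (fastforce simp: separator_def out_arcs_def)
  have bwd: "a \<in> backward_verts v TB" if "b \<in> Y" "(a, b) \<in> E" for a b
    using sep that s_less Y' backward_verts_step[of b v TB a]
    by (fastforce simp: separator_def in_arcs_def)
  have E: "E \<subseteq> list_order A \<union> list_order C \<union> set A \<times> ({s} \<union> set C) \<union> {s} \<times> set C"
    using arcs_in_order L by auto
  have sub: "list_order A \<subseteq> set A \<times> set A" "list_order C \<subseteq> set C \<times> set C"
    by (rule list_order_subset)+
  have "(w, v) \<in> list_order A \<union> list_order C \<union> set A \<times> ({s} \<union> set C) \<union> {s} \<times> set C"
    using against_order L by auto
  then have "w \<in> set A \<and> v \<in> set A \<or> w \<in> set C \<and> v \<in> set C \<or>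
      w \<in> set A \<and> (v = s \<or> v \<in> set C) \<or> w = s \<and> v \<in> set C"
    using sub by blast
  \<comment> \<open>\<open>w\<close> is forward and \<open>v\<close> backward, so \<open>w\<close>
    is in \<open>X\<close> exactly when it is below \<open>s\<close>, and \<open>v\<close> is in
    \<open>Y\<close> exactly when it is above \<open>s\<close>.\<close>
  then have vw: "w \<in> X \<and> v \<in> set A \<and> v \<notin> X \<or> w \<in> set C \<and> w \<notin> Y \<and> v \<in> Y \<or>
      w \<in> X \<and> (v = s \<or> v \<in> Y) \<or> w = s \<and> v \<in> Y"
    using disjoint_ends[OF disj] X' Y' by auto
  have L'_eq: "L' = (if s \<in> forward_verts w TF
      then filter (\<lambda>x. x \<notin> X) A @ OY @ OX @ s # filter (\<lambda>x. x \<notin> Y) C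
      else filter (\<lambda>x. x \<notin> X) A @ s # OY @ OX @ filter (\<lambda>x. x \<notin> Y) C)"
    using L' L0' dL by (simp add: insert_before_split insert_after_split)
  have "(a, b) \<in> list_order L'" if "(a, b) \<in> insert (v, w) E" for a b
  proof (cases "(a, b) \<in> E")
    case True
    with E consider "(a, b) \<in> list_order A" | "(a, b) \<in> list_order C" | "a \<in> set A" "b = s"
      | "a \<in> set A" "b \<in> set C" | "a = s" "b \<in> set C" by blast
    then show ?thesis
    proof cases
      case 1
      \<comment> \<open>If \<open>a\<close> moves, so does \<open>b\<close>, and \<open>OX\<close>
        orders them; if \<open>a\<close> stays, \<open>b\<close> stays or moves to the
        right.\<close>
      with sub have "a \<in> set A" "b \<in> set A" by auto
      with 1 True show ?thesis
        using fwd[of a b] X' OX' OX_arcs L'_eq by (auto simp: list_order_filter)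
    next
      case 2
      with sub have "a \<in> set C" "b \<in> set C" by auto
      with 2 True show ?thesis
        using bwd[of b a] Y' OY' OY_arcs L'_eq by (auto simp: list_order_filter)
    next
      case 3
      \<comment> \<open>If \<open>a\<close> is in \<open>X\<close>, the arc makes \<open>s\<close>
        forward, so the block is put before \<open>s\<close>.\<close>
      with True show ?thesis using fwd[of a b] L'_eq OX' by auto
    next
      case 4
      \<comment> \<open>Only an arc from \<open>X\<close> to \<open>Y\<close> would be reversed, and
        its tail would be both forward and backward.\<close>
      moreover have "\<not> (a \<in> X \<and> b \<in> Y)" using True bwd[of b a] disj X' by blast
      ultimately show ?thesis using L'_eq OX' OY' by auto
    next
      case 5
      \<comment> \<open>An arc from \<open>s\<close> into \<open>Y\<close> makes \<open>s\<close>
        backward, so the block is put after \<open>s\<close>.\<close>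
      moreover have "b \<in> Y \<Longrightarrow> s \<notin> forward_verts w TF" using True bwd[of b a] disj 5 by blast
      ultimately show ?thesis using L'_eq OY' by auto
    qed
  next
    case False
    with that have "a = v" "b = w" by auto
    then show ?thesis
      using vw disjoint_ends[OF disj] OX' OY' L'_eq by auto
  qed
  moreover have "distinct L'" "set L' = V"
    using dL OX' OY' X' Y' V L'_eq by auto
  ultimately show ?thesis by (auto simp: topological_list_iff)
qed

lemma search_outcome_Cycle:
  assumes "search_inv \<sigma>" "search_outcome G L v w \<sigma> (Cycle P x Q)"
  shows "pre_digraph.awalk G w P x" "pre_digraph.awalk G x Q v"
    "pre_digraph.cycle G (P @ Q @ [(v, w)])"
proof -
  obtain TF TB where "TF \<subseteq> E" "TB \<subseteq> E"
    "pre_digraph.awalk (digraph_of V TF) w P x" "pre_digraph.awalk (digraph_of V TB) x Q v"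
    using assms(2,1) by cases auto
  then have PQ: "pre_digraph.awalk (digraph_of V E) w P x"
    "pre_digraph.awalk (digraph_of V E) x Q v"
    by (auto intro: awalk_mono)
  then show "pre_digraph.awalk G w P x" "pre_digraph.awalk G x Q v"
    by (auto intro: awalk_mono)
  \<comment> \<open>The walks are joined in the old graph, where acyclicity makes the result
    simple.\<close>
  have "pre_digraph.awalk (digraph_of V E) w (P @ Q) v"
    using wf_digraph.awalk_appendI[OF wf_digraph_of[OF arcs_in_V] PQ] .
  from cycle_if_awalk_acyclic[OF arcs_in_V acyclic_E ends_in_V this]
  show "pre_digraph.cycle G (P @ Q @ [(v, w)])" by simp
qed

lemma search_outcome_Reordered:
  assumes "search_inv \<sigma>" "search_outcome G L v w \<sigma> (Reordered L')"
  shows "topological_list G L'"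
  using assms(2)
proof cases
  case (reorder X TF s Y TB OX OY L0)
  have "forward_verts w TF \<inter> backward_verts v TB = {}" "separator G L v w TF TB s"
    using assms(1) reorder(1) by simp_all
  then show ?thesis by (rule topological_list_reorder[OF _ _ reorder(2-7)])
qed

lemma search_terminates: "termip (search_step G L v w) \<sigma>"
proof (rule termip_search_step)
  have "finite E" using arcs_in_V set_L finite_subset by (metis List.finite_set finite_SigmaI)
  then show "finite (arcs G)" by simp
qed

text \<open>By induction along the terminating step relation: a state is final or has a successor
  from which a final state is reached.\<close>

lemma search_final_exists:
  "\<exists>\<sigma>'. (search_step G L v w)\<^sup>*\<^sup>* \<sigma> \<sigma>' \<and> (\<nexists>\<sigma>''. search_step G L v w \<sigma>' \<sigma>'')"
  using search_terminates[of \<sigma>]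
proof (rule accp_induct)
  fix \<sigma>
  assume IH: "\<forall>\<tau>. (search_step G L v w)\<inverse>\<inverse> \<tau> \<sigma> \<longrightarrow>
    (\<exists>\<sigma>'. (search_step G L v w)\<^sup>*\<^sup>* \<tau> \<sigma>' \<and> (\<nexists>\<sigma>''. search_step G L v w \<sigma>' \<sigma>''))"
  show "\<exists>\<sigma>'. (search_step G L v w)\<^sup>*\<^sup>* \<sigma> \<sigma>' \<and> (\<nexists>\<sigma>''. search_step G L v w \<sigma>' \<sigma>'')"
  proof (cases "\<exists>\<tau>. search_step G L v w \<sigma> \<tau>")
    case True
    then obtain \<tau> where step: "search_step G L v w \<sigma> \<tau>" ..
    with IH obtain \<sigma>' where "(search_step G L v w)\<^sup>*\<^sup>* \<tau> \<sigma>'" "\<nexists>\<sigma>''. search_step G L v w \<sigma>' \<sigma>''"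
      by blast
    then show ?thesis using converse_rtranclp_into_rtranclp[of "search_step G L v w", OF step] by blast
  next
    case False
    then show ?thesis by blast
  qed
qed

end

section \<open>Arc additions\<close>

lemma topological_list_no_cycle:
  assumes "topological_list (digraph_of V E) L"
  shows "\<nexists>p. pre_digraph.cycle (digraph_of V E) p"
proof (rule no_cycle_if_acyclic)
  have *: "distinct L" "set L = V" "E \<subseteq> list_order L"
    using assms by (auto simp: topological_list_iff)
  then show "E \<subseteq> V \<times> V" using list_order_subset[of L] by auto
  show "acyclic E" using acyclic_list_order[OF *(1)] *(3) by (rule acyclic_subset)
qed

lemma add_arc_outcome_Reordered:
  assumes "topological_list (digraph_of V E) L"
    and "add_arc_outcome (digraph_of V (insert (v, w) E)) L v w (Reordered L')"
  shows "topological_list (digraph_of V (insert (v, w) E)) L'"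
  using assms(2)
proof cases
  case in_order
  then show ?thesis using assms(1) by (auto simp: topological_list_iff)
next
  case (search \<sigma>)
  then interpret arc_insertion V E L v w
    using assms(1) by unfold_locales (auto simp: topological_list_iff)
  show ?thesis using search search_inv_reachable search_outcome_Reordered by blast
qed

lemma add_arc_outcome_Cycle:
  assumes top: "topological_list (digraph_of V E) L" and ends: "v \<in> V" "w \<in> V"
    and out: "add_arc_outcome (digraph_of V (insert (v, w) E)) L v w (Cycle P x Q)"
  shows "pre_digraph.awalk (digraph_of V (insert (v, w) E)) w P x \<and>
    pre_digraph.awalk (digraph_of V (insert (v, w) E)) x Q v \<and>
    pre_digraph.cycle (digraph_of V (insert (v, w) E)) (P @ Q @ [(v, w)])"
  using out
proof cases
  case loop
  have "distinct L" "set L = V" "E \<subseteq> list_order L"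
    using top by (auto simp: topological_list_iff)
  then have E: "E \<subseteq> V \<times> V" "acyclic E"
    using list_order_subset[of L] acyclic_list_order[of L] acyclic_subset by blast+
  \<comment> \<open>For a loop the old walk to be closed is the empty one at
    \<open>v\<close>.\<close>
  have walk: "pre_digraph.awalk (digraph_of V E) w [] v"
    using loop ends by (simp add: pre_digraph.awalk_def cas_with_proj_eq)
  then have "pre_digraph.awalk (digraph_of V (insert (v, w) E)) w [] v"
    by (rule awalk_mono) auto
  then show ?thesis
    using loop cycle_if_awalk_acyclic[OF E ends walk] by simp
next
  case (search \<sigma>)
  then interpret arc_insertion V E L v w
    using top by unfold_locales (auto simp: topological_list_iff)
  show ?thesis using search search_inv_reachable search_outcome_Cycle by blast
qed

text \<open>Keeps statements about all outcomes from being vacuous. Totality of the order leaves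
  three cases, one for each rule.\<close>

lemma add_arc_outcome_exists:
  assumes top: "topological_list (digraph_of V E) L" and ends: "v \<in> V" "w \<in> V"
  shows "\<exists>out. add_arc_outcome (digraph_of V (insert (v, w) E)) L v w out"
proof -
  consider "(v, w) \<in> list_order L" | "v = w" | "(w, v) \<in> list_order L"
    using total_on_list_order[of L] ends top by (auto simp: total_on_def topological_list_iff)
  then show ?thesis
  proof cases
    case 1
    then show ?thesis by (blast intro: add_arc_outcome.in_order)
  next
    case 2
    then show ?thesis by (blast intro: add_arc_outcome.loop)
  next
    case 3
    then interpret arc_insertion V E L v w
      using top by unfold_locales (auto simp: topological_list_iff)
    show ?thesis
      using search_final_exists search_inv_reachable search_outcome_exists
        add_arc_outcome.search[OF 3] by blast
  qed
qed

text \<open>Carries the order invariant along the whole sequence, so that it suffices to study one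
  further addition.\<close>

lemma run_topological_list:
  assumes "run V es L"
  shows "topological_list (digraph_of V (set es)) L"
  using assms
proof (induction rule: run.induct)
  case (init L)
  then show ?case by (simp add: topological_list_iff)
next
  case (add es L v w L')
  then show ?case using add_arc_outcome_Reordered[of V "set es" L v w L'] by simp
qed

theorem theorem1:
  fixes V :: "'a set" and es :: "('a \<times> 'a) list" and L :: "'a list" and v w :: 'a
    and G :: "('a, 'a \<times> 'a) pre_digraph"
  assumes "finite V" and "run V es L" and "v \<in> V" and "w \<in> V"
    and "G = digraph_of V (set (es @ [(v, w)]))"
  shows
    "((w, v) \<in> list_order L \<longrightarrow>
        termip (search_step G L v w) search_start \<and>
        (\<forall>\<sigma>. (search_step G L v w)\<^sup>*\<^sup>* search_start \<sigma> \<and> (\<nexists>\<sigma>'. search_step G L v w \<sigma> \<sigma>') \<longrightarrow>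
             (\<exists>out. search_outcome G L v w \<sigma> out))) \<and>
     (\<exists>out. add_arc_outcome G L v w out) \<and>
     (\<forall>out. add_arc_outcome G L v w out \<longrightarrow>
        ((\<exists>P x Q. out = Cycle P x Q) \<longleftrightarrow> (\<exists>p. pre_digraph.cycle G p))) \<and>
     (\<forall>P x Q. add_arc_outcome G L v w (Cycle P x Q) \<longrightarrow>
        pre_digraph.awalk G w P x \<and> pre_digraph.awalk G x Q v \<and>
        pre_digraph.cycle G (P @ Q @ [(v, w)])) \<and>
     ((\<nexists>p. pre_digraph.cycle G p) \<longrightarrow>
        (\<forall>out. add_arc_outcome G L v w out \<longrightarrow>
           (\<exists>L'. out = Reordered L' \<and> topological_list G L')))"
proof -
  have top: "topological_list (digraph_of V (set es)) L"
    by (rule run_topological_list[OF assms(2)])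
  have G: "G = digraph_of V (insert (v, w) (set es))" using assms(5) by simp
  have search: "termip (search_step G L v w) search_start \<and>
      (\<forall>\<sigma>. (search_step G L v w)\<^sup>*\<^sup>* search_start \<sigma> \<and> (\<nexists>\<sigma>'. search_step G L v w \<sigma> \<sigma>') \<longrightarrow>
           (\<exists>out. search_outcome G L v w \<sigma> out))" if "(w, v) \<in> list_order L"
  proof -
    interpret S: arc_insertion V "set es" L v w
      using that top by unfold_locales (auto simp: topological_list_iff)
    show ?thesis
      unfolding G using S.search_terminates S.search_inv_reachable S.search_outcome_exists by blast
  qed
  have ex: "\<exists>out. add_arc_outcome G L v w out"
    unfolding G by (rule add_arc_outcome_exists[OF top assms(3,4)])
  have cyc: "pre_digraph.awalk G w P x \<and> pre_digraph.awalk G x Q v \<and>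
      pre_digraph.cycle G (P @ Q @ [(v, w)])" if "add_arc_outcome G L v w (Cycle P x Q)" for P x Q
    using add_arc_outcome_Cycle[OF top assms(3,4)] that unfolding G by blast
  have reord: "topological_list G L'" if "add_arc_outcome G L v w (Reordered L')" for L'
    using add_arc_outcome_Reordered[OF top] that unfolding G by blast
  have nocyc: "\<nexists>p. pre_digraph.cycle G p" if "add_arc_outcome G L v w (Reordered L')" for L'
    using reord[OF that] topological_list_no_cycle unfolding G by blast
  \<comment> \<open>A report exhibits a cycle, while a reordering yields a topological order and so
    excludes one.\<close>
  have "(\<exists>P x Q. out = Cycle P x Q) \<longleftrightarrow> (\<exists>p. pre_digraph.cycle G p)"
    if "add_arc_outcome G L v w out" for out
    using that cyc nocyc by (cases out) blast+
  moreover have "\<exists>L'. out = Reordered L' \<and> topological_list G L'"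
    if "\<nexists>p. pre_digraph.cycle G p" "add_arc_outcome G L v w out" for out
    using that cyc reord by (cases out) blast+
  ultimately show ?thesis using search ex cyc by blast
qed

end
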